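(* Let $d\ge1$, $\mathcal{R}=\mathrm{GF}(2)[x_1,x_1^{-1},\ldots,x_d,x_d^{-1}]$, and let $F\in\mathcal{R}$ with $\mathrm{height}(F)\le 1$. Let $a_n(F)$ be the number of ON cells at generation $n$ of the odd-rule cellular automaton with neighborhood $F$ started at generation $0$ with a single ON cell at the origin. Then the sequence $[a_n(F),\ n\ge 0]$ is the run length transform of the sequence $[a_0(F),a_1(F),a_3(F),a_7(F),\ldots,a_{2^k-1}(F),\ldots]$, i.e., for every $n\ge0$, $$a_n(F)=\prod_{i\in\mathcal{L}(n)} a_{2^i-1}(F).$$
   Context: Cells are points of $\mathbb{Z}^d$, cell $u$ identified with monomial $x^u=x_1^{u_1}\cdots x_d^{u_d}$; a finite state is the mod-2 sum in $\mathcal{R}$ of the monomials of its ON cells. The neighborhood of the origin is $F\in\mathcal{R}$ and the neighborhood of cell $w$ is $x^wF$. Odd-rule CA: cell $u$ is ON at generation $n+1$ iff an odd number of cells $w$ ON at generation $n$ have $x^u$ as a monomial of $x^wF$. The height $\mathrm{height}(P)$ of $P\in\mathcal{R}$ is the maximum of $|e_i|$ over all monomials $x_1^{e_1}\cdots x_d^{e_d}$ appearing in $P$. For an integer $n\ge0$, $\mathcal{L}(n)$ is the list of lengths of the maximal runs of 1s in the binary expansion of $n$ (e.g. $\mathcal{L}(55)=[2,3]$, $\mathcal{L}(0)$ is empty). The run length transform of a sequence $[S_n,n\ge0]$ is $[T_n,n\ge0]$ with $T_n=\prod_{i\in\mathcal{L}(n)}S_i$ (so $T_0=1$, the empty product).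 *)

theory Defs
  imports "HOL-Analysis.Finite_Cartesian_Product" "HOL-Library.Poly_Mapping" "HOL-Library.Z2"
begin

text \<open>
  Laurent polynomials over GF(2) in variables indexed by \<open>'d\<close> form the monoid algebra of the
  exponent group \<open>int ^ 'd\<close> with coefficients in the field \<open>bit\<close>; the product of the type
  \<open>\<Rightarrow>\<^sub>0\<close> is convolution.  The monomials appearing in \<open>P\<close> are the elements of \<open>Poly_Mapping.keys P\<close>.
\<close>

type_synonym 'd cell = "int ^ 'd"
type_synonym 'd laurent = "(int ^ 'd) \<Rightarrow>\<^sub>0 bit"

definition cell_monom :: "'d::finite cell \<Rightarrow> 'd laurent" where
  "cell_monom u = Poly_Mapping.single u 1"

text \<open>The element 0 is inserted only to give the zero polynomial, which has no monomials, height 0.\<close>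

definition height :: "'d::finite laurent \<Rightarrow> int" where
  "height P = Max (insert 0 {\<bar>e $ i\<bar> | e i. e \<in> Poly_Mapping.keys P})"

text \<open>A state is represented by the set of its ON cells.\<close>

definition ca_step :: "'d::finite laurent \<Rightarrow> 'd cell set \<Rightarrow> 'd cell set" where
  "ca_step F S = {u. odd (card {w \<in> S. u \<in> Poly_Mapping.keys (cell_monom w * F)})}"

definition on_cells :: "'d::finite laurent \<Rightarrow> nat \<Rightarrow> 'd cell set" where
  "on_cells F n = (ca_step F ^^ n) {0}"

definition num_on :: "'d::finite laurent \<Rightarrow> nat \<Rightarrow> nat" where
  "num_on F n = card (on_cells F n)"

text \<open>
  A maximal run of 1s in the binary expansion is identified by the position of its least
  significant bit.  The runs are listed from the most significant one downwards.
\<close>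

definition run_starts :: "nat \<Rightarrow> nat set" where
  "run_starts n = {i. bit n i \<and> (i = 0 \<or> \<not> bit n (i - 1))}"

definition run_length_at :: "nat \<Rightarrow> nat \<Rightarrow> nat" where
  "run_length_at n i = (LEAST l. \<not> bit n (i + l))"

definition run_lengths :: "nat \<Rightarrow> nat list" where
  "run_lengths n = map (run_length_at n) (rev (sorted_list_of_set (run_starts n)))"

definition run_length_transform :: "(nat \<Rightarrow> nat) \<Rightarrow> nat \<Rightarrow> nat" where
  "run_length_transform S n = prod_list (map S (run_lengths n))"

lemma run_lengths_0: "run_lengths 0 = []"
  by (simp add: run_lengths_def run_starts_def)

lemma run_lengths_55: "run_lengths 55 = [2, 3]"
proof -
  have small: "i < 6" if "bit (55::nat) i" for i
  proof (rule ccontr)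
    assume "\<not> i < 6"
    then have "(2::nat) ^ 6 \<le> 2 ^ i"
      by (intro power_increasing) auto
    then have "(55::nat) div 2 ^ i = 0"
      by simp
    with that show False
      by (simp add: bit_iff_odd)
  qed
  have lt6: "i < 6 \<longleftrightarrow> i = 0 \<or> i = 1 \<or> i = 2 \<or> i = 3 \<or> i = 4 \<or> i = 5" for i :: nat
    by arith
  have "i \<in> run_starts 55 \<longleftrightarrow> i \<in> {0, 4}" for i
  proof (cases "i < 6")
    case True
    then show ?thesis
      unfolding lt6 by (elim disjE) (simp_all add: run_starts_def bit_iff_odd)
  next
    case False
    then show ?thesis
      using small[of i] by (auto simp only: run_starts_def mem_Collect_eq insert_iff empty_iff)
  qed
  then have "run_starts 55 = {0, 4}"
    by blast
  moreover have "run_length_at 55 0 = 3"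
    unfolding run_length_at_def
  proof (rule Least_equality)
    fix y assume y: "\<not> bit (55::nat) (0 + y)"
    show "3 \<le> y"
    proof (rule ccontr)
      assume "\<not> 3 \<le> y"
      then have "y = 0 \<or> y = 1 \<or> y = 2" by arith
      with y show False by (auto simp: bit_iff_odd)
    qed
  qed (simp add: bit_iff_odd)
  moreover have "run_length_at 55 4 = 2"
    unfolding run_length_at_def
  proof (rule Least_equality)
    fix y assume y: "\<not> bit (55::nat) (4 + y)"
    show "2 \<le> y"
    proof (rule ccontr)
      assume "\<not> 2 \<le> y"
      then have "y = 0 \<or> y = 1" by arith
      with y show False by (auto simp: bit_iff_odd)
    qed
  qed (simp add: bit_iff_odd)
  ultimately show ?thesis
    by (simp add: run_lengths_def)
qed

end

theory Submission
  imports Defs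
begin

text \<open>
  Generation \<open>n\<close> consists of the monomials of \<open>F ^ n\<close>.  If \<open>k\<close> is the length of the block of 1s at
  the bottom of \<open>n\<close>, then \<open>n = 2 ^ (k + 1) * m + (2 ^ k - 1)\<close>, and by the Frobenius map
  \<open>F ^ n = (F ^ m) ^ 2 ^ (k + 1) * F ^ (2 ^ k - 1)\<close>.  The exponents of the first factor are multiples
  of \<open>2 ^ (k + 1)\<close>, those of the second have absolute value less than \<open>2 ^ k\<close>, so no two products of
  monomials coincide and the numbers of monomials multiply.
\<close>

section \<open>Sums of monomials over GF(2)\<close>

lemma lookup_sum: "Poly_Mapping.lookup (sum f A) x = (\<Sum>a\<in>A. Poly_Mapping.lookup (f a) x)"
  by (induction A rule: infinite_finite_induct) (simp_all add: lookup_add)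

lemma sum_bit_eq_1_iff:
  fixes f :: "'a \<Rightarrow> bit"
  assumes "finite A"
  shows "sum f A = 1 \<longleftrightarrow> odd (card {a \<in> A. f a \<noteq> 0})"
  using assms
proof (induction A)
  case (insert a A)
  have "{b \<in> insert a A. f b \<noteq> 0} =
      (if f a = 0 then {b \<in> A. f b \<noteq> 0} else insert a {b \<in> A. f b \<noteq> 0})"
    by auto
  with insert show ?case
    by (cases "f a"; cases "sum f A") auto
qed simp

text \<open>Mod 2, only equal monomials can cancel, and injectivity of \<open>g\<close> rules this
  out.\<close>

lemma keys_sum_single:
  assumes "finite A" "inj_on g A"
  shows "Poly_Mapping.keys (\<Sum>a\<in>A. Poly_Mapping.single (g a) (1::bit)) = g ` A"
proof -
  have "x \<in> Poly_Mapping.keys (\<Sum>a\<in>A. Poly_Mapping.single (g a) (1::bit)) \<longleftrightarrow> x \<in> g ` A" for x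
  proof -
    have "Poly_Mapping.lookup (\<Sum>a\<in>A. Poly_Mapping.single (g a) (1::bit)) x =
        (\<Sum>y\<in>g ` A. Poly_Mapping.lookup (Poly_Mapping.single y 1) x)"
      by (simp add: lookup_sum sum.reindex[OF assms(2)])
    also have "\<dots> = (if x \<in> g ` A then 1 else 0)"
      using assms(1) by (simp add: lookup_single when_def)
    finally show ?thesis
      by (simp add: in_keys_iff)
  qed
  then show ?thesis by blast
qed

lemma sum_single_keys:
  fixes P :: "'a \<Rightarrow>\<^sub>0 bit"
  shows "(\<Sum>u\<in>Poly_Mapping.keys P. Poly_Mapping.single u 1) = P"
proof (rule poly_mapping_eqI)
  fix x
  show "Poly_Mapping.lookup (\<Sum>u\<in>Poly_Mapping.keys P. Poly_Mapping.single u 1) x =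
      Poly_Mapping.lookup P x"
    by (cases "Poly_Mapping.lookup P x") (simp_all add: lookup_sum lookup_single when_def in_keys_iff)
qed

section \<open>Generations as powers of \<open>F\<close>\<close>

lemma ca_step_keys: "ca_step F (Poly_Mapping.keys P) = Poly_Mapping.keys (P * F)"
proof -
  have "u \<in> Poly_Mapping.keys (P * F) \<longleftrightarrow> u \<in> ca_step F (Poly_Mapping.keys P)" for u
  proof -
    \<comment> \<open>The product superposes the neighborhoods of the ON cells, so its coefficient
      at \<open>u\<close> is the parity that \<open>ca_step\<close> tests.\<close>
    have "P * F = (\<Sum>w\<in>Poly_Mapping.keys P. cell_monom w * F)"
      by (simp add: cell_monom_def flip: sum_distrib_right) (simp add: sum_single_keys)
    then have "Poly_Mapping.lookup (P * F) u =
        (\<Sum>w\<in>Poly_Mapping.keys P. Poly_Mapping.lookup (cell_monom w * F) u)"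
      by (simp add: lookup_sum)
    moreover have "u \<in> Poly_Mapping.keys (P * F) \<longleftrightarrow> Poly_Mapping.lookup (P * F) u = 1"
      by (cases "Poly_Mapping.lookup (P * F) u") (simp_all add: in_keys_iff)
    ultimately show ?thesis
      by (simp add: sum_bit_eq_1_iff ca_step_def in_keys_iff)
  qed
  then show ?thesis by blast
qed

lemma on_cells_eq_keys: "on_cells F n = Poly_Mapping.keys (F ^ n)"
proof (induction n)
  case 0
  then show ?case
    by (simp add: on_cells_def flip: single_one)
next
  case (Suc n)
  have "on_cells F (Suc n) = ca_step F (on_cells F n)"
    by (simp add: on_cells_def)
  with Suc show ?case
    by (simp add: ca_step_keys mult.commute)
qed

lemma num_on_eq: "num_on F n = card (Poly_Mapping.keys (F ^ n))"
  by (simp add: num_on_def on_cells_eq_keys)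

section \<open>Frobenius map and products without cancellation\<close>

lemma frobenius_sum:
  fixes f :: "'a \<Rightarrow> 'b::comm_ring_1"
  assumes "(1::'b) + 1 = 0"
  shows "(sum f A)\<^sup>2 = (\<Sum>a\<in>A. (f a)\<^sup>2)"
proof -
  \<comment> \<open>This kills the cross term in \<open>power2_sum\<close>.\<close>
  have "(2::'b) = 0"
    using assms by simp
  then show ?thesis
    by (induction A rule: infinite_finite_induct) (simp_all add: power2_sum)
qed

text \<open>Each squaring is additive in characteristic 2, so it only doubles the exponents; the
  coefficients stay 1.\<close>

lemma power_two_power_eq_sum:
  fixes P :: "'d::finite laurent"
  shows "P ^ 2 ^ j = (\<Sum>u\<in>Poly_Mapping.keys P. Poly_Mapping.single (2 ^ j *s u) 1)"
proof (induction j)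
  case 0
  then show ?case by (simp add: sum_single_keys)
next
  case (Suc j)
  have char: "(1::'d laurent) + 1 = 0"
    by (simp flip: single_one single_add)
  have "P ^ 2 ^ Suc j = (P ^ 2 ^ j)\<^sup>2"
    by (simp add: mult.commute flip: power_mult)
  also have "\<dots> = (\<Sum>u\<in>Poly_Mapping.keys P. (Poly_Mapping.single (2 ^ j *s u) 1)\<^sup>2)"
    by (simp add: Suc frobenius_sum[OF char])
  also have "\<dots> = (\<Sum>u\<in>Poly_Mapping.keys P. Poly_Mapping.single (2 ^ Suc j *s u) 1)"
    by (simp add: power2_eq_square mult_single vector_sadd_rdistrib[symmetric])
  finally show ?case .
qed

lemma abs_le_height:
  assumes "e \<in> Poly_Mapping.keys P"
  shows "\<bar>e $ i\<bar> \<le> height P"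
proof -
  have "{\<bar>e $ i\<bar> | e i. e \<in> Poly_Mapping.keys P} =
      (\<lambda>(e, i). \<bar>e $ i\<bar>) ` (Poly_Mapping.keys P \<times> UNIV)"
    by auto
  then have "finite {\<bar>e $ i\<bar> | e i. e \<in> Poly_Mapping.keys P}"
    by simp
  with assms show ?thesis
    unfolding height_def by (intro Max_ge) auto
qed

lemma abs_keys_power_le:
  assumes "e \<in> Poly_Mapping.keys (F ^ n)"
  shows "\<bar>e $ i\<bar> \<le> int n * height F"
  using assms
proof (induction n arbitrary: e)
  case 0
  then show ?case by (simp flip: single_one)
next
  case (Suc n)
  then obtain a b where ab: "a \<in> Poly_Mapping.keys F" "b \<in> Poly_Mapping.keys (F ^ n)" "e = a + b"
    using keys_mult[of F "F ^ n"] by auto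
  have "\<bar>e $ i\<bar> \<le> \<bar>a $ i\<bar> + \<bar>b $ i\<bar>"
    using ab by simp
  also have "\<dots> \<le> height F + int n * height F"
    using ab abs_le_height[OF ab(1)] Suc.IH[OF ab(2)] by (intro add_mono)
  finally show ?case
    by (simp add: algebra_simps)
qed

text \<open>In each coordinate, the entries of \<open>v\<close> and \<open>v'\<close> are congruent
  mod \<open>c\<close> and differ by less than \<open>c\<close>, hence agree; then the multiples of
  \<open>c\<close> agree too.\<close>

lemma inj_on_scaled_add:
  fixes A B :: "'d::finite cell set"
  assumes "\<And>v i. v \<in> B \<Longrightarrow> 2 * \<bar>v $ i\<bar> < c"
  shows "inj_on (\<lambda>(u, v). c *s u + v) (A \<times> B)"
proof (rule inj_onI, clarify)
  fix u v u' v'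
  assume mem: "v \<in> B" "v' \<in> B" and eq: "c *s u + v = c *s u' + v'"
  have "u $ i = u' $ i \<and> v $ i = v' $ i" for i
  proof -
    have eq_i: "c * (u $ i - u' $ i) = v' $ i - v $ i"
      using arg_cong[OF eq, of "\<lambda>x. x $ i"] by (simp add: algebra_simps)
    have "\<bar>v' $ i - v $ i\<bar> < c"
      using assms[OF mem(1), of i] assms[OF mem(2), of i] by linarith
    moreover have "c dvd v' $ i - v $ i"
      by (simp flip: eq_i)
    ultimately have "v' $ i - v $ i = 0"
      using dvd_imp_le_int[of "v' $ i - v $ i" c] by linarith
    \<comment> \<open>The bound at a member of \<open>B\<close> forces \<open>c\<close> to be
      positive.\<close>
    moreover have "c \<noteq> 0"
      using assms[OF mem(1), of i] by auto
    ultimately show ?thesis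
      using eq_i by simp
  qed
  then show "u = u' \<and> v = v'"
    by (simp add: vec_eq_iff)
qed

lemma card_keys_power_mult:
  fixes P Q :: "'d::finite laurent"
  assumes "\<And>v i. v \<in> Poly_Mapping.keys Q \<Longrightarrow> 2 * \<bar>v $ i\<bar> < 2 ^ j"
  shows "card (Poly_Mapping.keys (P ^ 2 ^ j * Q)) =
    card (Poly_Mapping.keys P) * card (Poly_Mapping.keys Q)"
proof -
  let ?g = "\<lambda>(u, v). 2 ^ j *s u + v" and ?K = "Poly_Mapping.keys P \<times> Poly_Mapping.keys Q"
  have "P ^ 2 ^ j * Q = P ^ 2 ^ j * (\<Sum>v\<in>Poly_Mapping.keys Q. Poly_Mapping.single v 1)"
    by (simp add: sum_single_keys)
  also have "\<dots> = (\<Sum>x\<in>?K. Poly_Mapping.single (?g x) 1)"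
    by (simp add: power_two_power_eq_sum sum_product mult_single sum.cartesian_product
        case_prod_beta)
  finally have "Poly_Mapping.keys (P ^ 2 ^ j * Q) = ?g ` ?K"
    using inj_on_scaled_add[OF assms] by (simp add: keys_sum_single)
  then show ?thesis
    using inj_on_scaled_add[OF assms] by (simp add: card_image card_cartesian_product)
qed

lemma num_on_mult:
  assumes "height F \<le> 1"
  shows "num_on F (2 ^ Suc k * m + (2 ^ k - 1)) = num_on F m * num_on F (2 ^ k - 1)"
proof -
  \<comment> \<open>The height hypothesis enters here: exponents are at most
    \<open>2 ^ k - 1\<close> in absolute value. The 0 bit above the run supplies the factor 2 that
    separates both signs.\<close>
  have bound: "2 * \<bar>v $ i\<bar> < 2 ^ Suc k" if "v \<in> Poly_Mapping.keys (F ^ (2 ^ k - 1))" for v i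
  proof -
    have "\<bar>v $ i\<bar> \<le> int (2 ^ k - 1) * height F"
      by (rule abs_keys_power_le[OF that])
    also have "\<dots> \<le> int (2 ^ k - 1) * 1"
      using assms by (intro mult_left_mono) auto
    also have "\<dots> < 2 ^ k"
      by (simp add: of_nat_diff)
    finally show ?thesis by simp
  qed
  have "F ^ (2 ^ Suc k * m + (2 ^ k - 1)) = (F ^ m) ^ 2 ^ Suc k * F ^ (2 ^ k - 1)"
    by (simp only: power_add power_mult mult.commute[of _ m])
  then show ?thesis
    using card_keys_power_mult[OF bound] by (simp only: num_on_eq)
qed

section \<open>Peeling off the lowest run of 1s\<close>

lemma not_bit_run_length: "\<not> bit n (i + run_length_at n i)"
proof -
  \<comment> \<open>A witness that some bit at or above \<open>i\<close> vanishes, so that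
    \<open>LEAST\<close> is meaningful.\<close>
  have "n < 2 ^ (i + n)"
    using less_exp[of "i + n"] by linarith
  then have "\<not> bit n (i + n)"
    by (simp add: bit_iff_odd)
  then show ?thesis
    unfolding run_length_at_def by (rule LeastI)
qed

lemma bit_run: "l < run_length_at n i \<Longrightarrow> bit n (i + l)"
  unfolding run_length_at_def using not_less_Least by blast

text \<open>The lowest \<open>Suc k\<close> bits are \<open>k\<close> ones below a zero, which is
  \<open>mask k\<close>. For even \<open>n\<close> this holds with \<open>k = 0\<close>.\<close>

lemma decompose_lowest_run:
  "n = 2 ^ Suc (run_length_at n 0) * drop_bit (Suc (run_length_at n 0)) n
    + (2 ^ run_length_at n 0 - 1)"
proof -
  let ?k = "run_length_at n 0"
  have "take_bit (Suc ?k) n = mask ?k"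
    using not_bit_run_length[of n 0] bit_run[of _ n 0]
    by (intro bit_eqI) (auto simp: bit_take_bit_iff bit_mask_iff less_Suc_eq)
  then show ?thesis
    using bits_ident[of "Suc ?k" n] by (simp add: push_bit_eq_mult mask_eq_exp_minus_1 mult.commute)
qed

lemma run_starts_lowest_run:
  fixes n :: nat
  defines "k \<equiv> run_length_at n 0"
  shows "run_starts n = (if k = 0 then {} else {0}) \<union> (+) (Suc k) ` run_starts (drop_bit (Suc k) n)"
    (is "_ = ?R")
proof -
  have nk: "\<not> bit n k" and below: "\<And>l. l < k \<Longrightarrow> bit n l"
    using not_bit_run_length[of n 0] bit_run[of _ n 0] by (simp_all add: k_def)
  have "i \<in> run_starts n \<longleftrightarrow> i \<in> ?R" for i
  proof (cases "i \<le> k")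
    case True
    then show ?thesis
      \<comment> \<open>For \<open>0 < i < k\<close> the bit below \<open>i\<close> is set, so no
        run starts there; bit \<open>k\<close> itself is 0.\<close>
      using nk below[of i] below[of "i - 1"] by (cases "i = k"; cases "i = 0") (auto simp: run_starts_def)
  next
    case False
    then obtain j where j: "i = Suc k + j"
      by (metis less_eq_Suc_le le_iff_add not_le)
    then have "i \<in> ?R \<longleftrightarrow> j \<in> run_starts (drop_bit (Suc k) n)"
      by auto
    also have "\<dots> \<longleftrightarrow> i \<in> run_starts n"
      \<comment> \<open>For \<open>j = 0\<close> the bit below \<open>i\<close> is bit
        \<open>k\<close>, which is 0, so a run at the bottom of the quotient is not the continuation
        of a lower one.\<close>
      using nk by (cases j) (auto simp: run_starts_def bit_drop_bit_eq j)
    finally show ?thesis ..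
  qed
  then show ?thesis by blast
qed

lemma run_length_at_drop_bit: "run_length_at (drop_bit a n) i = run_length_at n (a + i)"
  by (simp add: run_length_at_def bit_drop_bit_eq add.assoc)

lemma finite_run_starts: "finite (run_starts n)"
proof (rule finite_subset)
  show "run_starts n \<subseteq> {..n}"
    unfolding run_starts_def
    by (auto simp: bit_nat_def) (metis div_less even_zero less_exp less_trans not_le)
qed simp

lemma run_length_transform_eq_prod:
  "run_length_transform S n = (\<Prod>i\<in>run_starts n. S (run_length_at n i))"
  by (simp add: run_length_transform_def run_lengths_def comp_def rev_map[symmetric]
      prod_list.rev finite_run_starts flip: prod.distinct_set_conv_list)

text \<open>Removing the bottom block shifts the other runs without changing their lengths. The
  condition \<open>S 0 = 1\<close> covers even \<open>n\<close>, where the block is empty and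
  contributes no run.\<close>

lemma run_length_transform_lowest_run:
  fixes n :: nat
  assumes "S 0 = 1"
  defines "k \<equiv> run_length_at n 0"
  shows "run_length_transform S n = run_length_transform S (drop_bit (Suc k) n) * S k"
proof -
  let ?A = "run_starts (drop_bit (Suc k) n)"
  have "run_length_transform S n =
      (\<Prod>i\<in>(if k = 0 then {} else {0}). S (run_length_at n i)) *
      (\<Prod>i\<in>(+) (Suc k) ` ?A. S (run_length_at n i))"
    unfolding run_length_transform_eq_prod run_starts_lowest_run[of n] k_def
    by (rule prod.union_disjoint) (auto simp: finite_run_starts)
  also have "(\<Prod>i\<in>(+) (Suc k) ` ?A. S (run_length_at n i)) =
      run_length_transform S (drop_bit (Suc k) n)"
    unfolding run_length_transform_eq_prod
    by (subst prod.reindex) (simp_all add: run_length_at_drop_bit comp_def)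
  also have "(\<Prod>i\<in>(if k = 0 then {} else {0}). S (run_length_at n i)) = S k"
    using assms by simp
  finally show ?thesis
    by simp
qed

theorem theorem2:
  fixes F :: "'d::finite laurent"
  assumes "height F \<le> 1"
  shows "num_on F = run_length_transform (\<lambda>k. num_on F (2 ^ k - 1))"
proof
  fix n
  let ?S = "\<lambda>k. num_on F (2 ^ k - 1)"
  have one: "num_on F 0 = 1"
    by (simp add: num_on_def on_cells_def)
  show "num_on F n = run_length_transform ?S n"
  proof (induction n rule: less_induct)
    case (less n)
    show ?case
    proof (cases "n = 0")
      case True
      then show ?thesis
        by (simp add: one run_length_transform_def run_lengths_0)
    next
      case False
      define k where "k = run_length_at n 0"
      define m where "m = drop_bit (Suc k) n"
      \<comment> \<open>The separating zero is dropped along with the run, so the divisor is at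
        least 2 even if \<open>k = 0\<close>.\<close>
      have "m < n"
        using False unfolding m_def drop_bit_eq_div
        by (intro div_less_dividend one_less_power) simp_all
      have "num_on F n = num_on F m * ?S k"
        using decompose_lowest_run[of n] num_on_mult[OF assms, of k m] by (simp add: k_def m_def)
      also have "\<dots> = run_length_transform ?S m * ?S k"
        using less.IH[OF \<open>m < n\<close>] by simp
      also have "\<dots> = run_length_transform ?S n"
        using run_length_transform_lowest_run[of ?S n] one by (simp add: k_def m_def)
      finally show ?thesis .
    qed
  qed
qed

end
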